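(* Let $n,k,s,t$ be positive integers with $k\geq 2$, $s\geq 2$, $n\geq sk$ and $t=n-s(k-1)$. Then for every $m$ and every proper coloring $c$ of $KG^{2}(n,k)_{\widetilde{s\text{-}stab}}$ with colors $\{1,2,\ldots,m\}$, there is a complete bipartite subgraph $K_{\lceil t/2\rceil,\lfloor t/2\rfloor}$ whose $t$ vertices receive $t$ pairwise distinct colors $c_1<c_2<\cdots<c_t$, such that the vertices colored $c_1,c_3,c_5,\ldots$ form one side of the bipartition and the vertices colored $c_2,c_4,\ldots$ form the other side.
   Context: A $k$-subset $S\subseteq[n]$ is almost $s$-stable if $|i-j|\geq s$ for all distinct $i,j\in S$. The almost $s$-stable Kneser graph $KG^{2}(n,k)_{\widetilde{s\text{-}stab}}$ has as vertices the almost $s$-stable $k$-subsets of $[n]$, two vertices being adjacent iff they are disjoint. A proper coloring assigns colors to vertices so that adjacent vertices get different colors. A complete bipartite subgraph $K_{a,b}$ here means two disjoint vertex sets of sizes $a$ and $b$ with every vertex of one adjacent to every vertex of the other. *)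

theory Defs
  imports Complex_Main "HOL-Library.Ramsey" "HOL-Library.FuncSet" "Graph_Theory.Graph_Theory"
begin

text \<open>
  Undirected graphs are symmetric loop-free digraphs whose arcs are pairs of vertices,
  i.e. the locale \<^locale>\<open>pair_graph\<close>.
\<close>

definition almost_stable :: "nat \<Rightarrow> nat set \<Rightarrow> bool" where
  "almost_stable s S \<longleftrightarrow> (\<forall>i\<in>S. \<forall>j\<in>S. i \<noteq> j \<longrightarrow> \<bar>int i - int j\<bar> \<ge> int s)"

definition almost_stable_kneser :: "nat \<Rightarrow> nat \<Rightarrow> nat \<Rightarrow> nat set pair_pre_digraph" where
  "almost_stable_kneser n k s =
     (let V = {S \<in> nsets {1..n} k. almost_stable s S}
      in \<lparr> pverts = V, parcs = {(S, T). S \<in> V \<and> T \<in> V \<and> S \<inter> T = {}} \<rparr>)"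

text \<open>The empty set would carry a loop, so \<open>k > 0\<close> is needed.\<close>

lemma pair_graph_almost_stable_kneser:
  assumes "k > 0"
  shows "pair_graph (almost_stable_kneser n k s)"
proof -
  let ?V = "{S \<in> nsets {1..n} k. almost_stable s S}"
  have fin: "finite ?V"
    by (simp add: finite_imp_finite_nsets)
  have sub: "{(S, T). S \<in> ?V \<and> T \<in> ?V \<and> S \<inter> T = {}} \<subseteq> ?V \<times> ?V"
    by auto
  have nonempty: "S \<noteq> {}" if "S \<in> ?V" for S
    using that assms by (auto simp: nsets_def)
  show ?thesis
  proof unfold_locales
    show "finite (parcs (almost_stable_kneser n k s))"
      using finite_subset[OF sub] fin
      by (simp add: almost_stable_kneser_def Let_def)
    show "symmetric (with_proj (almost_stable_kneser n k s))"
      by (auto simp: symmetric_def almost_stable_kneser_def Let_def intro!: symI)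
  qed (use fin nonempty in \<open>auto simp: almost_stable_kneser_def Let_def\<close>)
qed

definition proper_coloring :: "'a pair_pre_digraph \<Rightarrow> nat \<Rightarrow> ('a \<Rightarrow> nat) \<Rightarrow> bool" where
  "proper_coloring G m c \<longleftrightarrow>
     c \<in> pverts G \<rightarrow> {1..m} \<and> (\<forall>(u, v)\<in>parcs G. c u \<noteq> c v)"

text \<open>
  The sides \<open>A\<close> and \<open>B\<close> are explicit arguments. The subgraph need not be induced.
\<close>

definition complete_bipartite_subgraph ::
    "'a pair_pre_digraph \<Rightarrow> nat \<Rightarrow> nat \<Rightarrow> 'a set \<Rightarrow> 'a set \<Rightarrow> bool" where
  "complete_bipartite_subgraph G a b A B \<longleftrightarrow>
     A \<subseteq> pverts G \<and> B \<subseteq> pverts G \<and> A \<inter> B = {} \<and>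
     finite A \<and> finite B \<and> card A = a \<and> card B = b \<and>
     (\<forall>u\<in>A. \<forall>v\<in>B. (u, v) \<in> parcs G)"

lemma complete_bipartite_subgraph_imp_subgraph:
  assumes "pair_graph G" "complete_bipartite_subgraph G a b A B"
  defines "H \<equiv> \<lparr> pverts = A \<union> B, parcs = A \<times> B \<union> B \<times> A \<rparr>"
  shows "subgraph (with_proj H) (with_proj G)" "K\<^bsub>a,b\<^esub> (with_proj H)"
proof -
  interpret pair_graph G by fact
  show K: "K\<^bsub>a,b\<^esub> (with_proj H)"
    using assms(2)
    by (auto simp: complete_bipartite_digraph_pair_def complete_bipartite_subgraph_def H_def)
  interpret H: pair_graph H
    using K by (rule pair_graphI_complete_bipartite)
  have "(v, u) \<in> parcs G" if "(u, v) \<in> parcs G" for u v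
    using that pair_sym_arcs by (auto simp: symmetric_def dest: symD)
  then show "subgraph (with_proj H) (with_proj G)"
    using assms(2) wf_digraph H.wf_digraph
    by (auto simp: subgraph_def complete_bipartite_subgraph_def H_def compatible_def)
qed

end

theory Submission
  imports Defs "HOL-Library.Multiset"
begin

text \<open>
  A signed set \<open>(A, B)\<close> is labelled by a signed colour, shifted by \<open>s (k - 1)\<close>, as soon as \<open>A\<close> or
  \<open>B\<close> contains a vertex; the sign tells which side carries the largest colour. Signed sets
  containing no vertex need only \<open>s (k - 1)\<close> absolute values: repeatedly discarding the elements at
  distance less than \<open>s\<close> from the minimum leaves, after at most \<open>k - 2\<close> rounds, two disjoint sets of
  diameter less than \<open>s\<close>, and these are told apart by \<open>s\<close> absolute values through their residues
  modulo \<open>s - 1\<close>. Fan's lemma yields a maximal chain with \<open>n\<close> alternating labels of increasing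
  absolute value, of which the last \<open>n - s (k - 1)\<close> are colours.
\<close>

section \<open>Alternating label sequences\<close>

text \<open>All labels of a maximal chain come from subsets of one signed set. The vertices behind
  positive labels therefore lie in its positive part and those behind negative labels in its
  negative part; as the parts are disjoint, every vertex of the first kind is adjacent to every one
  of the second.

  The obstacle is thrift: each absolute value spent on signed sets without a vertex costs one vertex
  of the zig-zag. Counting elements is too expensive, because the windows of \<open>A\<close> and
  \<open>B\<close> may lie apart and together hold \<open>2 * s\<close> points, while only
  \<open>s\<close> values are affordable per window. Modulo \<open>s - 1\<close> there are
  \<open>s - 1\<close> classes: the number of classes met supplies the values 1 to
  \<open>s - 1\<close>, and \<open>s\<close> itself serves all pairs with a class met by both sides.
  Modulus \<open>s\<close> would cost one value more, and \<open>s - 1\<close> still makes the order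
  of the two sides the same in all common classes. Up to \<open>k - 2\<close> rounds of discarding,
  plus the final window, give \<open>k - 1\<close> blocks of \<open>s\<close> values.\<close>

fun alternating :: "bool \<Rightarrow> int list \<Rightarrow> bool" where
  "alternating b [] \<longleftrightarrow> True"
| "alternating b (x # xs) \<longleftrightarrow> (x > 0 \<longleftrightarrow> b) \<and> alternating (\<not> b) xs"

text \<open>The labels along a chain appear in any order of absolute value, and Fan's condition
  concerns them after sorting; it is thus a property of the multiset.\<close>

definition alternates :: "bool \<Rightarrow> int list \<Rightarrow> bool" where
  "alternates b xs \<longleftrightarrow>
     (\<exists>ys. mset ys = mset xs \<and> sorted_wrt (<) (map abs ys) \<and> alternating b ys)"

text \<open>Allowing \<open>x = y\<close> also excludes 0, which \<open>alternating\<close> would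
  read as a negative entry.\<close>

definition noncomplementary :: "int list \<Rightarrow> bool" where
  "noncomplementary xs \<longleftrightarrow> (\<forall>x\<in>set xs. \<forall>y\<in>set xs. x + y \<noteq> 0)"

definition delete_nth :: "nat \<Rightarrow> 'a list \<Rightarrow> 'a list" where
  "delete_nth j xs = take j xs @ drop (Suc j) xs"

lemma delete_nth_Cons_0 [simp]: "delete_nth 0 (x # xs) = xs"
  by (simp add: delete_nth_def)

lemma delete_nth_Cons_Suc [simp]: "delete_nth (Suc j) (x # xs) = x # delete_nth j xs"
  by (simp add: delete_nth_def)

lemma mset_delete_nth:
  assumes "j < length xs"
  shows "mset (delete_nth j xs) = mset xs - {#xs ! j#}"
proof -
  have "mset xs = mset (take j xs @ xs ! j # drop (Suc j) xs)"
    using id_take_nth_drop[OF assms] by simp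
  then show ?thesis by (simp add: delete_nth_def)
qed

lemma set_delete_nth_subset: "set (delete_nth j xs) \<subseteq> set xs"
  by (auto simp: delete_nth_def dest: in_set_takeD in_set_dropD)

lemma sorted_delete_nth: "sorted (map f xs) \<Longrightarrow> sorted (map f (delete_nth j xs))"
proof (induction xs arbitrary: j)
  case Nil
  then show ?case by (simp add: delete_nth_def)
next
  case (Cons x xs)
  show ?case
  proof (cases j)
    case 0
    with Cons.prems show ?thesis by simp
  next
    case (Suc i)
    with Cons show ?thesis using set_delete_nth_subset[of i xs] by auto
  qed
qed

lemma not_alternating_both: "xs \<noteq> [] \<Longrightarrow> alternating b xs \<Longrightarrow> \<not> alternating (\<not> b) xs"
  by (cases xs) auto

lemma alternating_nth:
  "alternating b xs \<Longrightarrow> i < length xs \<Longrightarrow> xs ! i > 0 \<longleftrightarrow> (b \<longleftrightarrow> even i)"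
proof (induction xs arbitrary: b i)
  case (Cons x xs)
  then show ?case by (cases i) auto
qed simp

lemma card_Collect_less_Suc:
  "card {j. j < Suc n \<and> P j} = (if P 0 then 1 else 0) + card {j. j < n \<and> P (Suc j)}"
proof -
  have "{j. j < Suc n \<and> P j} = {j. j = 0 \<and> P 0} \<union> Suc ` {j. j < n \<and> P (Suc j)}"
    by (auto simp: image_def less_Suc_eq_0_disj)
  moreover have "card (Suc ` {j. j < n \<and> P (Suc j)}) = card {j. j < n \<and> P (Suc j)}"
    by (rule card_image) simp
  ultimately show ?thesis
    by (subst \<open>{j. j < Suc n \<and> P j} = _\<close>, subst card_Un_disjoint) auto
qed

text \<open>Door counting. A list alternating from sign \<open>b\<close> has one good deletion, its
  last entry; one alternating from the other sign also has one, its first entry. Any other list has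
  none or two, namely the two members of its only pair of neighbours of equal sign. The induction
  splits off the deletion of the head.\<close>

lemma odd_card_alternating_delete_nth:
  assumes "xs \<noteq> []"
  shows "odd (card {j. j < length xs \<and> alternating b (delete_nth j xs)}) \<longleftrightarrow>
         alternating b xs \<or> alternating (\<not> b) xs"
  using assms
proof (induction xs arbitrary: b)
  case (Cons x xs)
  show ?case
  proof (cases "xs = []")
    case True
    have "{j. j = 0 \<and> alternating b (delete_nth j [x])} = {0}" by auto
    with True show ?thesis by auto
  next
    case False
    have IH: "odd (card {j. j < length xs \<and> alternating (\<not> b) (delete_nth j xs)}) \<longleftrightarrow>
         alternating (\<not> b) xs \<or> alternating b xs"
      using Cons.IH[OF False, of "\<not> b"] by simp
    have ex: "\<not> (alternating b xs \<and> alternating (\<not> b) xs)"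
      using not_alternating_both[OF False] by blast
    show ?thesis
      using IH ex by (cases "x > 0"; cases b) (auto simp: card_Collect_less_Suc)
  qed
qed simp

text \<open>Entries of equal absolute value are equal, since they cannot be opposite. So
  \<open>abs\<close> is injective on the entries and ties cannot make two sorted orders
  differ.\<close>

lemma sorted_abs_mset_eq:
  fixes ys zs :: "int list"
  assumes "noncomplementary zs" "mset ys = mset zs" "sorted (map abs ys)" "sorted (map abs zs)"
  shows "ys = zs"
proof -
  have set: "set ys = set zs" using assms(2) by (rule mset_eq_setD)
  have "mset (map abs ys) = mset (map abs zs)" using assms(2) by (metis mset_map)
  then have "map abs ys = map abs zs"
    using assms(3,4) by (metis sorted_sort_id properties_for_sort)
  moreover have "inj_on abs (set ys \<union> set zs)"
  proof (rule inj_onI)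
    fix x y assume "x \<in> set ys \<union> set zs" "y \<in> set ys \<union> set zs" "\<bar>x\<bar> = \<bar>y\<bar>"
    then show "x = y" using assms(1) set
      by (metis Un_iff abs_eq_iff add.left_inverse noncomplementary_def)
  qed
  ultimately show ?thesis by (simp add: inj_on_map_eq_map)
qed

text \<open>Neighbours of an alternating list differ in sign, so equal absolute values would make
  them complementary.\<close>

lemma alternating_imp_strictly_sorted:
  "noncomplementary zs \<Longrightarrow> sorted (map abs zs) \<Longrightarrow> alternating b zs \<Longrightarrow>
   sorted_wrt (<) (map abs zs)"
proof (induction zs arbitrary: b)
  case (Cons x zs)
  have nc: "noncomplementary zs" using Cons.prems(1) by (simp add: noncomplementary_def)
  have ssorted: "sorted_wrt (<) (map abs zs)"
    using Cons nc by (intro Cons.IH[of "\<not> b"]) auto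
  show ?case
  proof (cases zs)
    case (Cons y ws)
    have "\<bar>x\<bar> \<noteq> \<bar>y\<bar>" and "\<bar>x\<bar> \<le> \<bar>y\<bar>"
      using Cons.prems unfolding Cons by (auto simp: noncomplementary_def abs_eq_iff)
    then have "\<bar>x\<bar> < \<bar>y\<bar>" by simp
    then show ?thesis using ssorted unfolding Cons by force
  qed simp
qed simp

lemma alternates_sorted:
  assumes "noncomplementary zs" "sorted (map abs zs)"
  shows "alternates b zs \<longleftrightarrow> alternating b zs"
proof
  assume "alternates b zs"
  then obtain ys where ys: "mset ys = mset zs" "sorted_wrt (<) (map abs ys)" "alternating b ys"
    by (auto simp: alternates_def)
  have "sorted (map abs ys)" using ys(2) by (simp add: strict_sorted_imp_sorted)
  then have "ys = zs" using sorted_abs_mset_eq assms ys(1) by blast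
  with ys show "alternating b zs" by simp
next
  assume "alternating b zs"
  then show "alternates b zs"
    using alternating_imp_strictly_sorted[OF assms] by (auto simp: alternates_def)
qed

lemma alternates_cong_mset: "mset xs = mset ys \<Longrightarrow> alternates b xs = alternates b ys"
  by (simp add: alternates_def)

lemma card_Collect_nth_mset:
  assumes "mset xs = mset ys"
  shows "card {j. j < length xs \<and> P (xs ! j)} = card {j. j < length ys \<and> P (ys ! j)}"
  using assms by (metis length_filter_conv_card mset_filter size_mset)

lemma odd_card_alternates_delete_nth:
  assumes "L \<noteq> []" "noncomplementary L"
  shows "odd (card {j. j < length L \<and> alternates b (delete_nth j L)}) \<longleftrightarrow>
         alternates b L \<or> alternates (\<not> b) L"
proof -
  define zs where "zs = sort_key abs L"
  \<comment> \<open>Whether a deletion is good depends only on the deleted value, which lets the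
    count pass from \<open>L\<close> to its sorted form.\<close>
  define P where "P x \<longleftrightarrow> (\<exists>ys. mset ys = mset L - {#x#} \<and> alternates b ys)" for x
  have ms: "mset zs = mset L" by (simp add: zs_def)
  have srt: "sorted (map abs zs)" by (simp add: zs_def)
  have nc: "noncomplementary zs"
    using assms(2) mset_eq_setD[OF ms] by (simp add: noncomplementary_def)
  have P: "alternates b (delete_nth j ys) \<longleftrightarrow> P (ys ! j)"
    if "mset ys = mset L" "j < length ys" for ys j
    unfolding P_def using mset_delete_nth[OF that(2)] that(1)
    by (metis alternates_cong_mset)
  have "card {j. j < length L \<and> alternates b (delete_nth j L)} = card {j. j < length L \<and> P (L ! j)}"
    using P[of L] by (intro arg_cong[where f=card]) auto
  also have "\<dots> = card {j. j < length zs \<and> P (zs ! j)}"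
    by (rule card_Collect_nth_mset) (simp add: ms)
  also have "\<dots> = card {j. j < length zs \<and> alternating b (delete_nth j zs)}"
  proof (intro arg_cong[where f=card] Collect_cong conj_cong refl)
    fix j assume j: "j < length zs"
    have "noncomplementary (delete_nth j zs)"
      using nc set_delete_nth_subset[of j zs] by (auto simp: noncomplementary_def)
    then show "P (zs ! j) \<longleftrightarrow> alternating b (delete_nth j zs)"
      using P[OF ms j] alternates_sorted sorted_delete_nth[OF srt] by blast
  qed
  finally have "odd (card {j. j < length L \<and> alternates b (delete_nth j L)}) \<longleftrightarrow>
      alternating b zs \<or> alternating (\<not> b) zs"
    using odd_card_alternating_delete_nth[of zs b] assms(1) ms by (metis mset_zero_iff)
  then show ?thesis
    using alternates_sorted[OF nc srt] alternates_cong_mset[OF ms] by blast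
qed

lemma not_alternates_both:
  assumes "L \<noteq> []" "noncomplementary L" "alternates b L"
  shows "\<not> alternates (\<not> b) L"
proof -
  define zs where "zs = sort_key abs L"
  have ms: "mset zs = mset L" by (simp add: zs_def)
  have srt: "sorted (map abs zs)" by (simp add: zs_def)
  have nc: "noncomplementary zs"
    using assms(2) mset_eq_setD[OF ms] by (simp add: noncomplementary_def)
  have "zs \<noteq> []" using ms assms(1) by auto
  then show ?thesis
    using assms(3) not_alternating_both alternates_sorted[OF nc srt] alternates_cong_mset[OF ms]
    by blast
qed

lemma alternating_map_uminus:
  "0 \<notin> set xs \<Longrightarrow> alternating b (map uminus xs) \<longleftrightarrow> alternating (\<not> b) xs"
  by (induction xs arbitrary: b) auto

lemma alternates_map_uminus_imp:
  assumes "0 \<notin> set xs" "alternates b xs"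
  shows "alternates (\<not> b) (map uminus xs)"
proof -
  obtain ys where ys: "mset ys = mset xs" "sorted_wrt (<) (map abs ys)" "alternating b ys"
    using assms(2) by (auto simp: alternates_def)
  have "0 \<notin> set ys" using ys(1) assms(1) by (metis mset_eq_setD)
  then have "alternating (\<not> b) (map uminus ys)" using ys(3) by (simp add: alternating_map_uminus)
  moreover have "map abs (map uminus ys) = map abs ys" by simp
  ultimately show ?thesis
    unfolding alternates_def using ys by (intro exI[of _ "map uminus ys"]) (simp add: o_def)
qed

lemma alternates_map_uminus:
  assumes "0 \<notin> set xs"
  shows "alternates b (map uminus xs) \<longleftrightarrow> alternates (\<not> b) xs"
proof
  assume "alternates b (map uminus xs)"
  then have "alternates (\<not> b) (map uminus (map uminus xs))"
    using assms by (intro alternates_map_uminus_imp) auto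
  then show "alternates (\<not> b) xs" by (simp add: o_def)
next
  assume "alternates (\<not> b) xs"
  then show "alternates b (map uminus xs)" using alternates_map_uminus_imp assms by fastforce
qed


section \<open>Fan's lemma for the barycentric subdivision of the cross-polytope\<close>

text \<open>The nonzero sign vectors: \<open>i\<close> is a plus and \<open>-i\<close> a minus at
  coordinate \<open>i\<close>, and \<open>uminus\<close> is the antipodal map. They are the vertices
  of the subdivided sphere.\<close>

definition signed_sets :: "nat \<Rightarrow> int set set" where
  "signed_sets n = {X. X \<noteq> {} \<and> abs ` X \<subseteq> {1..int n} \<and> inj_on abs X}"

text \<open>A maximal chain is stored as the order in which its elements enter, a signed
  permutation; its members are the sets of the nonempty prefixes.\<close>

definition facets :: "nat \<Rightarrow> int list set" where
  "facets n = {xs. distinct (map abs xs) \<and> abs ` set xs = {1..int n}}"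

definition chain_labels :: "(int set \<Rightarrow> int) \<Rightarrow> int list \<Rightarrow> int list" where
  "chain_labels l xs = map (\<lambda>i. l (set (take (Suc i) xs))) [0..<length xs]"

definition fan_labelling :: "nat \<Rightarrow> (int set \<Rightarrow> int) \<Rightarrow> bool" where
  "fan_labelling n l \<longleftrightarrow>
     (\<forall>X\<in>signed_sets n. l (uminus ` X) = - l X) \<and>
     (\<forall>X\<in>signed_sets n. \<forall>Y\<in>signed_sets n. X \<subseteq> Y \<longrightarrow> l X + l Y \<noteq> 0)"

lemma length_chain_labels [simp]: "length (chain_labels l xs) = length xs"
  by (simp add: chain_labels_def)

lemma length_facets: "xs \<in> facets n \<Longrightarrow> length xs = n"
  unfolding facets_def
  by (metis (mono_tags, lifting) card_atLeastAtMost_int distinct_card length_map list.set_map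
      mem_Collect_eq nat_int add.commute diff_add_cancel)

lemma finite_facets [simp]: "finite (facets n)"
proof (rule finite_subset)
  show "facets n \<subseteq> {xs. set xs \<subseteq> {-int n..int n} \<and> length xs = n}"
  proof (intro subsetI CollectI conjI)
    fix xs x assume xs: "xs \<in> facets n" and "x \<in> set xs"
    then have "\<bar>x\<bar> \<in> {1..int n}" unfolding facets_def by blast
    then show "x \<in> {-int n..int n}" by auto
  qed (rule length_facets)
qed (simp add: finite_lists_length_eq)

lemma signed_sets_take_facet:
  assumes "xs \<in> facets n" "i < n"
  shows "set (take (Suc i) xs) \<in> signed_sets n"
proof -
  have "xs \<noteq> []" using assms length_facets by fastforce
  moreover have "inj_on abs (set xs)" using assms(1) by (simp add: facets_def distinct_map)
  ultimately show ?thesis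
    using assms(1) set_take_subset[of "Suc i" xs]
    by (auto simp: signed_sets_def facets_def intro: inj_on_subset)
qed

lemma noncomplementary_chain_labels:
  assumes "fan_labelling n l" "xs \<in> facets n"
  shows "noncomplementary (chain_labels l xs)"
  unfolding noncomplementary_def
proof (intro ballI)
  have le: "l (set (take (Suc i) xs)) + l (set (take (Suc j) xs)) \<noteq> 0"
    if "i \<le> j" "j < n" for i j
  proof -
    have "set (take (Suc i) xs) \<subseteq> set (take (Suc j) xs)"
      using that by (intro set_take_subset_set_take) simp
    then show ?thesis
      using assms that signed_sets_take_facet[OF assms(2)] by (simp add: fan_labelling_def)
  qed
  fix x y assume "x \<in> set (chain_labels l xs)" "y \<in> set (chain_labels l xs)"
  then obtain i j where "x = l (set (take (Suc i) xs))" "y = l (set (take (Suc j) xs))" "i < n" "j < n"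
    using length_facets[OF assms(2)] by (auto simp: chain_labels_def)
  then show "x + y \<noteq> 0" using le[of i j] le[of j i] by (cases "i \<le> j") (auto simp: add.commute)
qed

lemma chain_labels_map_uminus:
  assumes "fan_labelling n l" "xs \<in> facets n"
  shows "chain_labels l (map uminus xs) = map uminus (chain_labels l xs)"
  using assms signed_sets_take_facet[OF assms(2)] length_facets[OF assms(2)]
  by (simp add: chain_labels_def fan_labelling_def take_map)

lemma fan_labelling_mono:
  assumes "fan_labelling (Suc n) l"
  shows "fan_labelling n l"
proof -
  have "signed_sets n \<subseteq> signed_sets (Suc n)" by (auto simp: signed_sets_def)
  then show ?thesis using assms unfolding fan_labelling_def by (meson subsetD)
qed

text \<open>The other facet of the sphere that shares the ridge obtained by dropping the \<open>j\<close>-th element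
  of the chain.\<close>

definition opposite :: "nat \<Rightarrow> int list \<Rightarrow> int list" where
  "opposite j xs = (if Suc j < length xs then xs[j := xs ! Suc j, Suc j := xs ! j]
                    else xs[j := - xs ! j])"

lemma length_opposite [simp]: "length (opposite j xs) = length xs"
  by (simp add: opposite_def)

lemma opposite_opposite: "j < length xs \<Longrightarrow> opposite j (opposite j xs) = xs"
  by (auto simp: opposite_def list_eq_iff_nth_eq nth_list_update)

lemma opposite_neq:
  assumes "xs \<in> facets n" "j < n"
  shows "opposite j xs \<noteq> xs"
proof -
  have len: "length xs = n" using assms length_facets by blast
  have "distinct xs" using assms(1) by (simp add: facets_def distinct_map)
  then have "xs ! Suc j \<noteq> xs ! j" if "Suc j < n"
    using that len by (simp add: nth_eq_iff_index_eq)
  moreover have "\<bar>xs ! j\<bar> \<in> {1..int n}"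
    using assms len nth_mem[of j xs] unfolding facets_def by blast
  then have "- xs ! j \<noteq> xs ! j" by auto
  moreover have "opposite j xs ! j = (if Suc j < n then xs ! Suc j else - xs ! j)"
    using assms len by (simp add: opposite_def)
  ultimately show ?thesis by metis
qed

lemma opposite_facets:
  assumes "xs \<in> facets n" "j < n"
  shows "opposite j xs \<in> facets n"
proof -
  have len: "length xs = n" using assms length_facets by blast
  have "mset (map abs (opposite j xs)) = mset (map abs xs)"
  proof (cases "Suc j < n")
    case True
    then show ?thesis using len by (simp add: opposite_def mset_swap)
  next
    case False
    then have "map abs (opposite j xs) = map abs xs"
      using assms len by (auto simp: opposite_def list_eq_iff_nth_eq nth_list_update)
    then show ?thesis by simp
  qed
  then show ?thesis
    using assms(1) unfolding facets_def
    by (metis (mono_tags, lifting) list.set_map mem_Collect_eq mset_eq_imp_distinct_iff mset_eq_setD)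
qed

text \<open>Swapping the entries \<open>j\<close> and \<open>j + 1\<close> alters only the prefix
  that ends between them, and negating the last entry alters only the full prefix.\<close>

lemma set_take_opposite:
  assumes "i \<noteq> j" "i < length xs" "j < length xs"
  shows "set (take (Suc i) (opposite j xs)) = set (take (Suc i) xs)"
proof (cases "i < j")
  case True
  then show ?thesis by (simp add: opposite_def)
next
  case False
  with assms have ij: "j < i" "Suc j < length xs" by auto
  have "take (Suc i) (opposite j xs) =
      (take (Suc i) xs)[j := take (Suc i) xs ! Suc j, Suc j := take (Suc i) xs ! j]"
    using ij by (simp add: opposite_def take_update_swap)
  then show ?thesis using ij assms by (simp only:) (rule set_swap; simp)
qed

lemma delete_nth_chain_labels_opposite:
  assumes "j < length xs"
  shows "delete_nth j (chain_labels l (opposite j xs)) = delete_nth j (chain_labels l xs)"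
proof -
  have "chain_labels l (opposite j xs) ! i = chain_labels l xs ! i" if "i \<noteq> j" "i < length xs" for i
    using set_take_opposite[of i j xs] that assms by (simp add: chain_labels_def)
  then have "take j (chain_labels l (opposite j xs)) = take j (chain_labels l xs)"
    and "drop (Suc j) (chain_labels l (opposite j xs)) = drop (Suc j) (chain_labels l xs)"
    using assms by (auto simp: list_eq_iff_nth_eq)
  then show ?thesis by (simp add: delete_nth_def)
qed

lemma even_card_involution:
  assumes "finite A" "\<And>x. x \<in> A \<Longrightarrow> f x \<in> A \<and> f x \<noteq> x \<and> f (f x) = x"
  shows "even (card A)"
  using assms
proof (induction "card A" arbitrary: A rule: less_induct)
  case less
  show ?case
  proof (cases "A = {}")
    case False
    then obtain x where x: "x \<in> A" by blast
    define B where "B = A - {x, f x}"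
    have A: "A = insert x (insert (f x) B)" "x \<notin> insert (f x) B" "f x \<notin> B" "finite B"
      using x less.prems(1) less.prems(2)[OF x] by (auto simp: B_def)
    have card: "card A = Suc (Suc (card B))"
      using A by (metis card_insert_disjoint finite_insert)
    have "f y \<in> B \<and> f y \<noteq> y \<and> f (f y) = y" if "y \<in> B" for y
    proof -
      have "y \<in> A" "y \<noteq> x" "y \<noteq> f x" using that by (auto simp: B_def)
      then have "f y \<noteq> x" "f y \<noteq> f x" using less.prems(2) x by metis+
      then show ?thesis using less.prems(2)[OF \<open>y \<in> A\<close>] by (simp add: B_def)
    qed
    then have "even (card B)" using less.hyps[of B] A card by simp
    then show ?thesis using card by simp
  qed simp
qed

lemma map_uminus_facets: "xs \<in> facets n \<Longrightarrow> map uminus xs \<in> facets n"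
  by (simp add: facets_def o_def image_image)

lemma facet_mem_top:
  assumes "xs \<in> facets (Suc n)"
  shows "- int (Suc n) \<in> set xs \<longleftrightarrow> int (Suc n) \<notin> set xs"
proof -
  have "int (Suc n) \<in> abs ` set xs" using assms by (simp add: facets_def)
  then obtain x where x: "x \<in> set xs" "\<bar>x\<bar> = int (Suc n)" by (metis imageE)
  moreover have "inj_on abs (set xs)" using assms by (simp add: facets_def distinct_map)
  moreover have "\<bar>- int (Suc n)\<bar> = \<bar>int (Suc n)\<bar>" "- int (Suc n) \<noteq> int (Suc n)" by simp_all
  ultimately show ?thesis unfolding inj_on_def by (metis abs_eq_iff abs_of_nat)
qed

text \<open>Identifies the boundary ridges of the hemisphere with the facets of the sphere one
  dimension lower.\<close>

lemma snoc_facets_iff: "ys @ [int (Suc n)] \<in> facets (Suc n) \<longleftrightarrow> ys \<in> facets n"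
proof
  assume "ys \<in> facets n"
  then show "ys @ [int (Suc n)] \<in> facets (Suc n)" by (auto simp: facets_def)
next
  assume a: "ys @ [int (Suc n)] \<in> facets (Suc n)"
  have "int (Suc n) \<notin> abs ` set ys" "insert (int (Suc n)) (abs ` set ys) = {1..int (Suc n)}"
    using a by (simp_all add: facets_def)
  then have "abs ` set ys = {1..int (Suc n)} - {int (Suc n)}" by blast
  also have "\<dots> = {1..int n}" by auto
  finally show "ys \<in> facets n" using a by (simp add: facets_def)
qed

text \<open>Only the hemisphere of facets containing \<open>n + 1\<close> is double counted. Its boundary is the sphere
  of the induction hypothesis, and its negatively alternating facets are the antipodes of the
  positively alternating facets of the other hemisphere.\<close>

lemma odd_card_alternates_facets:
  "fan_labelling n l \<Longrightarrow> odd (card {xs \<in> facets n. alternates True (chain_labels l xs)})"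
proof (induction n)
  case 0
  \<comment> \<open>The only facet is the empty chain, whose empty label list counts as
    alternating.\<close>
  have "{xs \<in> facets 0. alternates True (chain_labels l xs)} = {[]}"
    by (auto simp: facets_def alternates_def chain_labels_def)
  then show ?case by simp
next
  case (Suc n)
  let ?N = "int (Suc n)"
  let ?alt = "\<lambda>b xs. alternates b (chain_labels l xs)"
  define H where "H = {xs \<in> facets (Suc n). ?N \<in> set xs}"
  \<comment> \<open>\<open>D\<close> pairs the facets of \<open>H\<close> with their good ridges. In
    \<open>D1\<close> the ridge is on the boundary: across it the last entry \<open>n + 1\<close>
    becomes its negative and the facet leaves \<open>H\<close>.\<close>
  define J where "J xs = {j. j < Suc n \<and> alternates True (delete_nth j (chain_labels l xs))}" for xs
  define D where "D = Sigma H J"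
  define D1 where "D1 = {p \<in> D. snd p = n \<and> fst p ! n = ?N}"
  have finH: "finite H" by (simp add: H_def)
  have finJ: "finite (J xs)" for xs by (simp add: J_def)
  have finD: "finite D" using finH finJ by (simp add: D_def)
  have len: "length xs = Suc n" if "xs \<in> H" for xs using that length_facets by (auto simp: H_def)
  have nc: "noncomplementary (chain_labels l xs)" if "xs \<in> facets (Suc n)" for xs
    using noncomplementary_chain_labels[OF Suc.prems that] .
  have ne: "chain_labels l xs \<noteq> []" if "xs \<in> facets (Suc n)" for xs
    using length_facets[OF that] length_chain_labels[of l xs] by fastforce

  have "even (card (D - D1))"
  proof (rule even_card_involution[where f = "\<lambda>(xs, j). (opposite j xs, j)"])
    show "finite (D - D1)" using finD by simp
    fix p assume "p \<in> D - D1"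
    moreover obtain xs j where p: "p = (xs, j)" by (cases p)
    ultimately have xs: "xs \<in> facets (Suc n)" "?N \<in> set xs" "j < Suc n"
      and alt: "alternates True (delete_nth j (chain_labels l xs))"
      and nb: "\<not> (j = n \<and> xs ! n = ?N)"
      by (auto simp: D_def D1_def H_def J_def)
    have lx: "length xs = Suc n" using xs length_facets by blast
    have opp: "opposite j xs \<in> facets (Suc n)" using opposite_facets xs by blast
    have N: "?N \<in> set (opposite j xs)"
    proof (cases "j = n")
      case False
      then have "set (take (Suc n) (opposite j xs)) = set (take (Suc n) xs)"
        using set_take_opposite[of n j xs] lx xs by simp
      then show ?thesis using lx xs by simp
    next
      case True
      obtain i where i: "i < Suc n" "xs ! i = ?N" using xs lx by (metis in_set_conv_nth)
      then have "i \<noteq> n" using nb True by auto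
      then have "opposite j xs ! i = ?N" using True lx i by (simp add: opposite_def)
      then show ?thesis using i lx by (metis length_opposite nth_mem)
    qed
    \<comment> \<open>The involution must not lead into \<open>D1\<close>: negating the last entry
      yields \<open>n + 1\<close> only from its negative, which no facet of \<open>H\<close>
      contains.\<close>
    have top: "opposite n xs ! n = - xs ! n" using lx by (simp add: opposite_def)
    have "xs ! n \<noteq> - ?N" using facet_mem_top[OF xs(1)] xs(2) lx by (metis lessI nth_mem)
    then have "\<not> (j = n \<and> opposite j xs ! n = ?N)" using top by auto
    then show "(\<lambda>(xs, j). (opposite j xs, j)) p \<in> D - D1 \<and>
        (\<lambda>(xs, j). (opposite j xs, j)) p \<noteq> p \<and>
        (\<lambda>(xs, j). (opposite j xs, j)) ((\<lambda>(xs, j). (opposite j xs, j)) p) = p"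
      using p opp N alt xs lx opposite_neq[OF xs(1,3)] opposite_opposite[of j xs]
        delete_nth_chain_labels_opposite[of j xs l]
      by (auto simp: D_def D1_def H_def J_def)
  qed
  moreover have "card D1 = card {ys \<in> facets n. ?alt True ys}"
  proof (rule bij_betw_same_card[symmetric, where f = "\<lambda>ys. (ys @ [?N], n)"], rule bij_betwI')
    have lab: "delete_nth n (chain_labels l (ys @ [?N])) = chain_labels l ys" if "length ys = n" for ys
    proof -
      have "chain_labels l (ys @ [?N]) = chain_labels l ys @ [l (set (ys @ [?N]))]"
        using that by (simp add: chain_labels_def)
      then show ?thesis using that by (simp add: delete_nth_def)
    qed
    show "((xs @ [?N], n) = (ys @ [?N], n)) = (xs = ys)" for xs ys by simp
    show "(ys @ [?N], n) \<in> D1" if "ys \<in> {ys \<in> facets n. ?alt True ys}" for ys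
      using that lab[of ys] length_facets[of ys n] snoc_facets_iff[of ys n]
      by (auto simp: D1_def D_def H_def J_def)
    show "\<exists>ys\<in>{ys \<in> facets n. ?alt True ys}. p = (ys @ [?N], n)" if p: "p \<in> D1" for p
    proof -
      obtain xs where xs: "p = (xs, n)" "xs \<in> facets (Suc n)" "xs ! n = ?N"
        "alternates True (delete_nth n (chain_labels l xs))"
        using p by (auto simp: D1_def D_def H_def J_def)
      have "length xs = Suc n" using xs length_facets by blast
      then have e: "xs = take n xs @ [?N]" using xs(3)
        by (metis lessI order_refl take_Suc_conv_app_nth take_all)
      have "length (take n xs) = n" using \<open>length xs = Suc n\<close> by simp
      then have "take n xs \<in> facets n" "?alt True (take n xs)"
        using xs e lab[of "take n xs"] snoc_facets_iff[of "take n xs" n] by auto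
      then show ?thesis using xs(1) e by (intro bexI[of _ "take n xs"]) auto
    qed
  qed
  moreover have "odd (card {ys \<in> facets n. ?alt True ys})"
    using Suc.IH fan_labelling_mono[OF Suc.prems] by blast
  moreover have "card D = card (D - D1) + card D1"
    using finD by (subst card_Un_disjoint[symmetric]) (auto simp: D1_def intro: arg_cong[where f=card])
  ultimately have "odd (card D)" by simp
  moreover have "card D = (\<Sum>xs\<in>H. card (J xs))"
    using finH finJ by (simp add: D_def card_SigmaI)
  ultimately have "odd (card {xs \<in> H. odd (card (J xs))})"
    using finH by (simp add: even_sum_iff)
  moreover have "{xs \<in> H. odd (card (J xs))} = {xs \<in> H. ?alt True xs} \<union> {xs \<in> H. ?alt False xs}"
  proof -
    have "odd (card (J xs)) \<longleftrightarrow> ?alt True xs \<or> ?alt False xs" if "xs \<in> H" for xs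
      using odd_card_alternates_delete_nth[of "chain_labels l xs" True] ne nc that len[OF that]
      by (simp add: J_def H_def)
    then show ?thesis by auto
  qed
  moreover have "{xs \<in> H. ?alt True xs} \<inter> {xs \<in> H. ?alt False xs} = {}"
    using not_alternates_both[of _ True] ne nc by (auto simp: H_def)
  ultimately have odd: "odd (card {xs \<in> H. ?alt True xs} + card {xs \<in> H. ?alt False xs})"
    using finH by (simp add: card_Un_disjoint)
  have un: "0 \<notin> set (chain_labels l xs)" if "xs \<in> facets (Suc n)" for xs
    using nc[OF that] by (force simp: noncomplementary_def)
  have neg: "?alt b (map uminus xs) \<longleftrightarrow> ?alt (\<not> b) xs" if "xs \<in> facets (Suc n)" for xs b
    using alternates_map_uminus[OF un[OF that]] chain_labels_map_uminus[OF Suc.prems that] by simp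
  have "card {xs \<in> H. ?alt False xs} = card {xs \<in> facets (Suc n) - H. ?alt True xs}"
  proof (rule bij_betw_same_card[where f = "map uminus"], rule bij_betwI')
    show "(map uminus xs = map uminus ys) = (xs = ys)" for xs ys :: "int list"
      by (simp add: inj_map_eq_map)
    show "map uminus xs \<in> {xs \<in> facets (Suc n) - H. ?alt True xs}"
      if "xs \<in> {xs \<in> H. ?alt False xs}" for xs
    proof -
      have xs: "xs \<in> facets (Suc n)" "?N \<in> set xs" "?alt False xs" using that by (auto simp: H_def)
      then have "?N \<notin> set (map uminus xs)"
        using facet_mem_top[OF map_uminus_facets[OF xs(1)]] by (metis image_eqI list.set_map)
      then show ?thesis using xs neg[of xs True] map_uminus_facets[of xs] by (simp add: H_def)
    qed
    show "\<exists>xs\<in>{xs \<in> H. ?alt False xs}. ys = map uminus xs"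
      if "ys \<in> {xs \<in> facets (Suc n) - H. ?alt True xs}" for ys
      using that neg[of ys False] map_uminus_facets[of ys] facet_mem_top[of ys n]
      by (intro bexI[of _ "map uminus ys"]) (force simp: H_def o_def image_iff)+
  qed
  moreover have "{xs \<in> facets (Suc n). ?alt True xs} =
      {xs \<in> H. ?alt True xs} \<union> {xs \<in> facets (Suc n) - H. ?alt True xs}"
    by (auto simp: H_def)
  moreover have "{xs \<in> H. ?alt True xs} \<inter> {xs \<in> facets (Suc n) - H. ?alt True xs} = {}" by auto
  ultimately show ?case using odd finH by (simp add: card_Un_disjoint)
qed

theorem fan_lemma:
  assumes "fan_labelling n l"
  obtains xs ys where "xs \<in> facets n" "mset ys = mset (chain_labels l xs)"
    "sorted_wrt (<) (map abs ys)" "alternating True ys"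
proof -
  have "{xs \<in> facets n. alternates True (chain_labels l xs)} \<noteq> {}"
    using odd_card_alternates_facets[OF assms] by (metis card.empty even_zero)
  then show thesis using that by (auto simp: alternates_def)
qed


section \<open>Labelling signed sets by residues and colours\<close>

definition stable_subsets :: "nat \<Rightarrow> nat \<Rightarrow> nat set \<Rightarrow> nat set set" where
  "stable_subsets s k A = {S. S \<subseteq> A \<and> finite S \<and> card S = k \<and> almost_stable s S}"

text \<open>An arbitrary witness \<open>a\<close> replaces the minimum of \<open>A\<close>: the set
  is the same, but monotonicity is immediate and the empty set needs no exception.\<close>

definition rest :: "nat \<Rightarrow> nat set \<Rightarrow> nat set" where
  "rest s A = {x \<in> A. \<exists>a\<in>A. a + s \<le> x}"

lemma rest_mono: "A \<subseteq> B \<Longrightarrow> rest s A \<subseteq> rest s B"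
  by (auto simp: rest_def)

lemma rest_subset: "rest s A \<subseteq> A"
  by (auto simp: rest_def)

lemma rest_emptyD: "rest s A = {} \<Longrightarrow> x \<in> A \<Longrightarrow> y \<in> A \<Longrightarrow> y < x + s"
  unfolding rest_def by (auto simp: not_le[symmetric])

lemma stable_subsets_mono: "A \<subseteq> B \<Longrightarrow> stable_subsets s k A \<subseteq> stable_subsets s k B"
  by (auto simp: stable_subsets_def)

text \<open>The minimum of \<open>A\<close> lies at least \<open>s\<close> below every point of
  \<open>rest s A\<close>, so it extends any stable subset found there. \<open>k > 0\<close>
  guarantees that \<open>A\<close> has a point.\<close>

lemma stable_subsets_Suc_rest:
  assumes "stable_subsets s k (rest s A) \<noteq> {}" "k > 0" "s > 0"
  shows "stable_subsets s (Suc k) A \<noteq> {}"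
proof -
  obtain S where S: "S \<subseteq> rest s A" "finite S" "card S = k" "almost_stable s S"
    using assms(1) unfolding stable_subsets_def by blast
  define m where "m = (LEAST a. a \<in> A)"
  obtain x where "x \<in> S" using S(3) assms(2) by (metis all_not_in_conv card.empty less_irrefl)
  then have "x \<in> A" using S(1) rest_subset by blast
  then have m: "m \<in> A" unfolding m_def by (rule LeastI)
  have le: "m + s \<le> x" if "x \<in> S" for x
  proof -
    obtain a where "a \<in> A" "a + s \<le> x" using \<open>x \<in> S\<close> S(1) unfolding rest_def by blast
    moreover have "m \<le> a" unfolding m_def using \<open>a \<in> A\<close> by (rule Least_le)
    ultimately show ?thesis by simp
  qed
  have "m \<notin> S" using le[of m] assms(3) by auto
  moreover have "almost_stable s (insert m S)"
    unfolding almost_stable_def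
  proof (intro ballI impI)
    fix i j assume ij: "i \<in> insert m S" "j \<in> insert m S" "i \<noteq> j"
    then consider "i \<in> S" "j \<in> S" | "i = m" "j \<in> S" | "i \<in> S" "j = m" by blast
    then show "int s \<le> \<bar>int i - int j\<bar>"
    proof cases
      case 1
      then show ?thesis using S(4) ij(3) by (simp add: almost_stable_def)
    next
      case 2
      then show ?thesis using le[of j] by simp
    next
      case 3
      then show ?thesis using le[of i] by simp
    qed
  qed
  ultimately have "insert m S \<in> stable_subsets s (Suc k) A"
    using S(1-3) m rest_subset[of s A] by (simp add: stable_subsets_def subset_trans)
  then show ?thesis by blast
qed

lemma rest_empty_if_no_stable_pair:
  assumes "stable_subsets s 2 A = {}" "s > 0"
  shows "rest s A = {}"
proof (rule ccontr)
  assume "rest s A \<noteq> {}"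
  then obtain a x where "a \<in> A" "x \<in> A" "a + s \<le> x" by (auto simp: rest_def)
  then have "{a, x} \<in> stable_subsets s 2 A"
    using assms(2) by (auto simp: stable_subsets_def almost_stable_def)
  with assms(1) show False by blast
qed

section \<open>Labels for two sets of diameter less than \<open>s\<close>\<close>

definition residues_of :: "nat \<Rightarrow> nat set \<Rightarrow> nat set" where
  "residues_of s A = (\<lambda>x. x mod (s - 1)) ` A"

definition precedes :: "nat \<Rightarrow> nat set \<Rightarrow> nat set \<Rightarrow> bool" where
  "precedes s A B \<longleftrightarrow> (\<exists>x\<in>A. \<exists>y\<in>B. x mod (s - 1) = y mod (s - 1) \<and> x < y)"

text \<open>Without a common class the absolute value stays below \<open>s\<close>, and the owner of
  the least class fixes the sign. The value \<open>s\<close> is reserved for a common class, where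
  the side that comes first fixes the sign.\<close>

definition window_label :: "nat \<Rightarrow> nat set \<Rightarrow> nat set \<Rightarrow> int" where
  "window_label s A B =
     (let C = residues_of s A; D = residues_of s B in
      if C \<inter> D = {} then (if Min (C \<union> D) \<in> C then int (card (C \<union> D)) else - int (card (C \<union> D)))
      else if precedes s A B then int s else - int s)"

text \<open>If one residue class met \<open>A\<close> before \<open>B\<close> and another one \<open>B\<close> before \<open>A\<close>, the two gaps of length
  at least \<open>s - 1\<close> would not fit into the windows unless \<open>A\<close> and \<open>B\<close> shared a point.\<close>

lemma not_precedes_both:
  assumes "rest s A = {}" "rest s B = {}" "A \<inter> B = {}"
  shows "\<not> (precedes s A B \<and> precedes s B A)"
proof
  assume "precedes s A B \<and> precedes s B A"
  then obtain x y x' y' where xy: "x \<in> A" "y \<in> B" "x mod (s - 1) = y mod (s - 1)" "x < y"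
    and xy': "x' \<in> A" "y' \<in> B" "y' mod (s - 1) = x' mod (s - 1)" "y' < x'"
    unfolding precedes_def by blast
  have gap: "a + (s - 1) \<le> b" if "a mod (s - 1) = b mod (s - 1)" "a < b" for a b
  proof -
    have "s - 1 dvd b - a" using that by (metis mod_eq_dvd_iff_nat less_imp_le)
    then have "s - 1 \<le> b - a" using that(2) by (intro dvd_imp_le) simp_all
    then show ?thesis using that by simp
  qed
  have "x + (s - 1) \<le> y" "y' + (s - 1) \<le> x'" using gap xy(3,4) xy'(3,4) by blast+
  moreover have "x' < x + s" "y < y' + s"
    using rest_emptyD[OF assms(1) xy(1) xy'(1)] rest_emptyD[OF assms(2) xy'(2) xy(2)] by blast+
  \<comment> \<open>The bounds close up:
    \<open>y \<le> y' + (s - 1) \<le> x' \<le> x + (s - 1) \<le> y\<close>.\<close>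
  ultimately have "x' = y" by linarith
  then show False using assms(3) xy(2) xy'(1) by blast
qed

lemma precedes_either:
  assumes "residues_of s A \<inter> residues_of s B \<noteq> {}" "A \<inter> B = {}"
  shows "precedes s A B \<or> precedes s B A"
proof -
  obtain x y where xy: "x \<in> A" "y \<in> B" "x mod (s - 1) = y mod (s - 1)"
    using assms(1) unfolding residues_of_def by blast
  then have "x \<noteq> y" using assms(2) by blast
  then consider "x < y" | "y < x" by linarith
  then show ?thesis using xy unfolding precedes_def by cases metis+
qed

lemma precedes_mono: "precedes s A B \<Longrightarrow> A \<subseteq> A' \<Longrightarrow> B \<subseteq> B' \<Longrightarrow> precedes s A' B'"
  unfolding precedes_def by blast

lemma finite_residues_of: "finite A \<Longrightarrow> finite (residues_of s A)"
  by (simp add: residues_of_def)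

lemma card_residues_of:
  assumes "s \<ge> 2" "finite A" "finite B" "A \<union> B \<noteq> {}"
  shows "1 \<le> card (residues_of s A \<union> residues_of s B)" "card (residues_of s A \<union> residues_of s B) < s"
proof -
  have "residues_of s A \<union> residues_of s B \<subseteq> {..<s - 1}"
    using assms(1) by (auto simp: residues_of_def)
  then have "card (residues_of s A \<union> residues_of s B) \<le> s - 1"
    using card_mono[of "{..<s - 1}"] by simp
  then show "card (residues_of s A \<union> residues_of s B) < s" using assms(1) by simp
  have "residues_of s A \<union> residues_of s B \<noteq> {}" using assms(4) by (auto simp: residues_of_def)
  then show "1 \<le> card (residues_of s A \<union> residues_of s B)"
    using assms(2,3) finite_residues_of by (simp add: Suc_le_eq card_gt_0_iff)
qed

lemma window_label_bounds:
  assumes "s \<ge> 2" "finite A" "finite B" "A \<union> B \<noteq> {}"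
  shows "window_label s A B \<noteq> 0" "\<bar>window_label s A B\<bar> \<le> int s"
  using card_residues_of[OF assms] assms(1) by (auto simp: window_label_def Let_def)

lemma window_label_swap:
  assumes "s \<ge> 2" "finite A" "finite B" "A \<union> B \<noteq> {}" "A \<inter> B = {}" "rest s A = {}" "rest s B = {}"
  shows "window_label s B A = - window_label s A B"
proof (cases "residues_of s A \<inter> residues_of s B = {}")
  case True
  have "residues_of s A \<union> residues_of s B \<noteq> {}" using assms(4) by (auto simp: residues_of_def)
  then have "Min (residues_of s A \<union> residues_of s B) \<in> residues_of s A \<union> residues_of s B"
    using assms(2,3) by (intro Min_in) (auto simp: finite_residues_of)
  then show ?thesis using True by (auto simp: window_label_def Let_def Un_commute Int_commute)
next
  case False
  then have "residues_of s B \<inter> residues_of s A \<noteq> {}" by blast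
  with False show ?thesis
    using not_precedes_both[OF assms(6,7,5)] precedes_either[OF False assms(5)]
    by (auto simp: window_label_def Let_def)
qed

text \<open>A common class of the smaller pair persists, and since only one order can occur the sign
  persists too. If only the larger pair has one, the absolute values differ. If neither has, equal
  absolute values force equal unions of classes; each side then keeps its own classes, hence the
  sign.\<close>

lemma window_label_mono:
  assumes "s \<ge> 2" "finite A'" "finite B'" "A \<union> B \<noteq> {}" "A' \<inter> B' = {}" "rest s A' = {}" "rest s B' = {}"
    and "A \<subseteq> A'" "B \<subseteq> B'"
  shows "window_label s A B + window_label s A' B' \<noteq> 0"
proof -
  have fin: "finite A" "finite B" and ne: "A' \<union> B' \<noteq> {}"
    using assms finite_subset by blast+
  note card = card_residues_of[OF assms(1) fin assms(4)]
  note card' = card_residues_of[OF assms(1-3) ne]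
  let ?C = "residues_of s A" and ?D = "residues_of s B"
  let ?C' = "residues_of s A'" and ?D' = "residues_of s B'"
  have sub: "?C \<subseteq> ?C'" "?D \<subseteq> ?D'" using assms by (auto simp: residues_of_def)
  have abs_small: "\<bar>window_label s A B\<bar> < int s" if "?C \<inter> ?D = {}"
    using that card by (auto simp: window_label_def Let_def)
  have abs_large: "\<bar>window_label s A' B'\<bar> = int s" if "?C' \<inter> ?D' \<noteq> {}"
    using that by (auto simp: window_label_def Let_def)
  consider "?C \<inter> ?D \<noteq> {}" | "?C \<inter> ?D = {}" "?C' \<inter> ?D' \<noteq> {}" | "?C' \<inter> ?D' = {}" "?C \<inter> ?D = {}"
    by blast
  then show ?thesis
  proof cases
    case 1
    then have ne': "?C' \<inter> ?D' \<noteq> {}" using sub by blast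
    have "A \<inter> B = {}" using assms(5,8,9) by blast
    then have "precedes s A B \<or> precedes s B A" using precedes_either 1 by blast
    then have "precedes s A B \<longleftrightarrow> precedes s A' B'"
      using precedes_mono[of s A B A' B'] precedes_mono[of s B A B' A'] assms(8,9)
        not_precedes_both[OF assms(6,7,5)] by blast
    then show ?thesis using 1 ne' assms(1) by (simp add: window_label_def Let_def)
  next
    case 2
    then show ?thesis using abs_small abs_large by linarith
  next
    case 3
    show ?thesis
    proof
      assume z: "window_label s A B + window_label s A' B' = 0"
      then have "card (?C \<union> ?D) = card (?C' \<union> ?D')"
        using 3 by (auto simp: window_label_def Let_def split: if_splits)
      moreover have "finite (?C' \<union> ?D')" using assms(2,3) finite_residues_of by simp
      ultimately have "?C \<union> ?D = ?C' \<union> ?D'" using sub by (intro card_subset_eq) auto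
      then have "?C = ?C'" "?D = ?D'" using sub 3 by blast+
      then have "window_label s A B = window_label s A' B'"
        using 3 by (simp add: window_label_def)
      then show False using z window_label_bounds(1)[OF assms(1) fin assms(4)] by simp
    qed
  qed
qed

section \<open>Labels for signed sets without a vertex\<close>

text \<open>Peeling off the first window of both signs raises the label by \<open>s\<close>. Since \<open>rest\<close> is monotone,
  the number of rounds grows along chains.\<close>

primrec level_label :: "nat \<Rightarrow> nat \<Rightarrow> nat set \<Rightarrow> nat set \<Rightarrow> int" where
  "level_label s 0 A B = window_label s A B"
| "level_label s (Suc k) A B =
     (if rest s A = {} \<and> rest s B = {} then window_label s A B
      else let l = level_label s k (rest s A) (rest s B) in l + sgn l * int s)"

text \<open>The offset 2 is what \<open>level_label s k\<close> calls for: after \<open>k\<close>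
  rounds no stable pair is left, so both sets have diameter less than \<open>s\<close>.\<close>

lemma stable_subsets_rest_empty:
  assumes "stable_subsets s (Suc k + 2) A = {}" "s \<ge> 2"
  shows "stable_subsets s (k + 2) (rest s A) = {}"
  using stable_subsets_Suc_rest[of s "k + 2" A] assms by auto

lemma finite_rest: "finite A \<Longrightarrow> finite (rest s A)"
  by (simp add: rest_def)

text \<open>Each of at most \<open>k\<close> rounds adds \<open>s\<close> away from zero, and the
  final window contributes at most \<open>s\<close> more.\<close>

lemma level_label_bounds:
  assumes "s \<ge> 2" "finite A" "finite B" "A \<union> B \<noteq> {}"
  shows "level_label s k A B \<noteq> 0 \<and> \<bar>level_label s k A B\<bar> \<le> int (s * Suc k)"
  using assms
proof (induction k arbitrary: A B)
  case 0
  then show ?case using window_label_bounds by simp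
next
  case (Suc k)
  show ?case
  proof (cases "rest s A = {} \<and> rest s B = {}")
    case True
    have "int s \<le> int (s * Suc (Suc k))" by simp
    then show ?thesis
      using window_label_bounds[OF Suc.prems] True by (metis level_label.simps(2) order_trans)
  next
    case False
    let ?l = "level_label s k (rest s A) (rest s B)"
    have "?l \<noteq> 0 \<and> \<bar>?l\<bar> \<le> int (s * Suc k)"
      using False Suc.prems by (intro Suc.IH) (auto simp: finite_rest)
    then show ?thesis using False by (auto simp: Let_def sgn_if)
  qed
qed

lemma level_label_swap:
  assumes "s \<ge> 2" "finite A" "finite B" "A \<union> B \<noteq> {}" "A \<inter> B = {}"
    and "stable_subsets s (k + 2) A = {}" "stable_subsets s (k + 2) B = {}"
  shows "level_label s k B A = - level_label s k A B"
  using assms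
proof (induction k arbitrary: A B)
  case 0
  have "rest s A = {}" "rest s B = {}"
    using 0 by (intro rest_empty_if_no_stable_pair; simp add: numeral_2_eq_2)+
  then show ?case using window_label_swap[OF 0(1-5)] by simp
next
  case (Suc k)
  show ?case
  proof (cases "rest s A = {} \<and> rest s B = {}")
    case True
    then show ?thesis using window_label_swap Suc.prems by simp
  next
    case False
    have "rest s A \<union> rest s B \<noteq> {}" "rest s A \<inter> rest s B = {}"
      using False Suc.prems(5) rest_subset[of s A] rest_subset[of s B] by blast+
    then have "level_label s k (rest s B) (rest s A) = - level_label s k (rest s A) (rest s B)"
      using Suc.prems(1) finite_rest[OF Suc.prems(2)] finite_rest[OF Suc.prems(3)]
        stable_subsets_rest_empty[OF Suc.prems(6,1)] stable_subsets_rest_empty[OF Suc.prems(7,1)]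
      by (intro Suc.IH)
    moreover have "\<not> (rest s B = {} \<and> rest s A = {})" using False by blast
    ultimately show ?thesis using False by (simp only: level_label.simps if_False Let_def) simp
  qed
qed

text \<open>If the larger pair stops, so does the smaller. If only the smaller stops, its label is
  at most \<open>s\<close> in absolute value and the other exceeds \<open>s\<close>. If both go on,
  both labels move away from zero by \<open>s\<close>, which creates no new cancellation.\<close>

lemma level_label_mono:
  assumes "s \<ge> 2" "finite A'" "finite B'" "A \<union> B \<noteq> {}" "A' \<inter> B' = {}"
    and "stable_subsets s (k + 2) A' = {}" "stable_subsets s (k + 2) B' = {}"
    and "A \<subseteq> A'" "B \<subseteq> B'"
  shows "level_label s k A B + level_label s k A' B' \<noteq> 0"
  using assms
proof (induction k arbitrary: A B A' B')
  case 0
  have "rest s A' = {}" "rest s B' = {}"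
    using 0 by (intro rest_empty_if_no_stable_pair; simp add: numeral_2_eq_2)+
  then show ?case using window_label_mono[OF 0(1-5) _ _ 0(8,9)] by simp
next
  case (Suc k)
  have fin: "finite A" "finite B" using Suc.prems finite_subset by blast+
  have sub: "rest s A \<subseteq> rest s A'" "rest s B \<subseteq> rest s B'"
    using Suc.prems rest_mono by blast+
  let ?l = "level_label s k (rest s A) (rest s B)" and ?l' = "level_label s k (rest s A') (rest s B')"
  show ?case
  proof (cases "rest s A' = {} \<and> rest s B' = {}")
    case True
    then have "rest s A = {} \<and> rest s B = {}" using sub by blast
    then show ?thesis using window_label_mono[OF Suc.prems(1-5) _ _ Suc.prems(8,9)] True by simp
  next
    case False
    then have L': "level_label s (Suc k) A' B' = ?l' + sgn ?l' * int s"
      by (simp only: level_label.simps if_False Let_def)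
    have "rest s A' \<union> rest s B' \<noteq> {}" using False by blast
    then have l': "?l' \<noteq> 0"
      using level_label_bounds[OF Suc.prems(1) finite_rest[OF Suc.prems(2)] finite_rest[OF Suc.prems(3)]]
      by simp
    show ?thesis
    proof (cases "rest s A = {} \<and> rest s B = {}")
      case True
      then have "level_label s (Suc k) A B = window_label s A B" by simp
      moreover have "\<bar>window_label s A B\<bar> \<le> int s"
        using window_label_bounds(2)[OF Suc.prems(1) fin Suc.prems(4)] .
      ultimately show ?thesis using L' l' by (auto simp: sgn_if split: if_splits)
    next
      case False
      then have L: "level_label s (Suc k) A B = ?l + sgn ?l * int s"
        by (simp only: level_label.simps if_False Let_def)
      have ne: "rest s A \<union> rest s B \<noteq> {}" using False by blast
      then have "?l \<noteq> 0"
        using level_label_bounds[OF Suc.prems(1) finite_rest[OF fin(1)] finite_rest[OF fin(2)]] by simp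
      moreover have "rest s A' \<inter> rest s B' = {}"
        using Suc.prems(5) rest_subset[of s A'] rest_subset[of s B'] by blast
      then have "?l + ?l' \<noteq> 0"
        using Suc.prems(1) finite_rest[OF Suc.prems(2)] finite_rest[OF Suc.prems(3)] ne sub
          stable_subsets_rest_empty[OF Suc.prems(6,1)] stable_subsets_rest_empty[OF Suc.prems(7,1)]
        by (intro Suc.IH)
      ultimately show ?thesis using L L' l' by (auto simp: sgn_if split: if_splits)
    qed
  qed
qed

section \<open>Labels by colours\<close>

definition kneser_label :: "(nat set \<Rightarrow> nat) \<Rightarrow> nat \<Rightarrow> nat \<Rightarrow> nat set \<Rightarrow> nat set \<Rightarrow> int" where
  "kneser_label c s k A B =
     (let V = stable_subsets s k A; W = stable_subsets s k B; M = Max (c ` (V \<union> W)) in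
      if V \<union> W = {} then level_label s (k - 2) A B
      else if M \<in> c ` V then int (s * (k - 1) + M) else - int (s * (k - 1) + M))"

text \<open>Positivity keeps the colour labels strictly above \<open>s * (k - 1)\<close> in absolute
  value, apart from the level labels.\<close>

definition kneser_coloring :: "nat \<Rightarrow> nat \<Rightarrow> nat \<Rightarrow> (nat set \<Rightarrow> nat) \<Rightarrow> bool" where
  "kneser_coloring n k s c \<longleftrightarrow>
     (\<forall>S\<in>stable_subsets s k {1..n}. c S > 0) \<and>
     (\<forall>S\<in>stable_subsets s k {1..n}. \<forall>T\<in>stable_subsets s k {1..n}. S \<inter> T = {} \<longrightarrow> c S \<noteq> c T)"

lemma finite_stable_subsets: "finite A \<Longrightarrow> finite (stable_subsets s k A)"
  by (rule finite_subset[of _ "Pow A"]) (auto simp: stable_subsets_def)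

lemma kneser_coloring_disjoint:
  assumes "kneser_coloring n k s c" "A \<subseteq> {1..n}" "B \<subseteq> {1..n}" "A \<inter> B = {}"
    and "S \<in> stable_subsets s k A" "T \<in> stable_subsets s k B"
  shows "c S \<noteq> c T"
proof -
  have "S \<in> stable_subsets s k {1..n}" "T \<in> stable_subsets s k {1..n}"
    using assms stable_subsets_mono by blast+
  moreover have "S \<inter> T = {}" using assms by (auto simp: stable_subsets_def)
  ultimately show ?thesis using assms(1) by (auto simp: kneser_coloring_def)
qed

lemma kneser_label_small:
  assumes "stable_subsets s k A \<union> stable_subsets s k B = {}" "s \<ge> 2" "k \<ge> 2"
    and "finite A" "finite B" "A \<union> B \<noteq> {}"
  shows "kneser_label c s k A B = level_label s (k - 2) A B"
    and "\<bar>kneser_label c s k A B\<bar> \<le> int (s * (k - 1))"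
proof -
  show eq: "kneser_label c s k A B = level_label s (k - 2) A B"
    using assms(1) by (simp add: kneser_label_def)
  have "Suc (k - 2) = k - 1" using assms(3) by simp
  then show "\<bar>kneser_label c s k A B\<bar> \<le> int (s * (k - 1))"
    using level_label_bounds[OF assms(2,4-6), of "k - 2"] eq by metis
qed

lemma kneser_label_large:
  assumes "stable_subsets s k A \<union> stable_subsets s k B \<noteq> {}" "kneser_coloring n k s c"
    and "A \<subseteq> {1..n}" "B \<subseteq> {1..n}"
  obtains S where "S \<in> stable_subsets s k (if kneser_label c s k A B > 0 then A else B)"
    "\<bar>kneser_label c s k A B\<bar> = int (s * (k - 1) + c S)" "c S > 0"
proof -
  let ?V = "stable_subsets s k A" and ?W = "stable_subsets s k B"
  define M where "M = Max (c ` (?V \<union> ?W))"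
  have "finite A" "finite B" using assms(3,4) finite_subset by blast+
  then have "finite (?V \<union> ?W)" by (simp add: finite_stable_subsets)
  then have M: "M \<in> c ` (?V \<union> ?W)" unfolding M_def using assms(1) by (intro Max_in) auto
  have sub: "?V \<union> ?W \<subseteq> stable_subsets s k {1..n}"
    using stable_subsets_mono[OF assms(3)] stable_subsets_mono[OF assms(4)] by blast
  have pos: "c S > 0" if "S \<in> ?V \<union> ?W" for S
    using subsetD[OF sub that] assms(2) by (simp add: kneser_coloring_def)
  have lab: "kneser_label c s k A B = (if M \<in> c ` ?V then int (s * (k - 1) + M) else - int (s * (k - 1) + M))"
    using assms(1) by (simp only: kneser_label_def Let_def if_False M_def)
  show thesis
  proof (cases "M \<in> c ` ?V")
    case True
    then obtain S where S: "S \<in> ?V" "c S = M" by blast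
    have "c S > 0" using S(1) by (intro pos) blast
    moreover have "kneser_label c s k A B = int (s * (k - 1) + c S)" using lab True S(2) by simp
    ultimately have "kneser_label c s k A B > 0" "\<bar>kneser_label c s k A B\<bar> = int (s * (k - 1) + c S)"
      by linarith+
    then show thesis using S(1) \<open>c S > 0\<close> that[of S] by (simp only: if_True)
  next
    case False
    then obtain S where S: "S \<in> ?W" "c S = M" using M by blast
    have "c S > 0" using S(1) by (intro pos) blast
    moreover have "kneser_label c s k A B = - int (s * (k - 1) + c S)" using lab False S(2) by simp
    ultimately have "\<not> kneser_label c s k A B > 0" "\<bar>kneser_label c s k A B\<bar> = int (s * (k - 1) + c S)"
      by linarith+
    then show thesis using S(1) \<open>c S > 0\<close> that[of S] by (simp only: if_False)
  qed
qed

text \<open>Vertices inside \<open>A\<close> are disjoint from those inside \<open>B\<close>, so no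
  colour occurs on both sides and the largest one determines its side.\<close>

lemma kneser_label_swap:
  assumes "s \<ge> 2" "k \<ge> 2" "kneser_coloring n k s c" "A \<subseteq> {1..n}" "B \<subseteq> {1..n}"
    and "A \<inter> B = {}" "A \<union> B \<noteq> {}"
  shows "kneser_label c s k B A = - kneser_label c s k A B"
proof (cases "stable_subsets s k A \<union> stable_subsets s k B = {}")
  case True
  have "finite A" "finite B" using assms(4,5) by (simp_all add: finite_subset)
  moreover have "k - 2 + 2 = k" using assms by simp
  ultimately show ?thesis
    using True level_label_swap[of s A B "k - 2"] assms by (simp add: kneser_label_def)
next
  case False
  let ?V = "stable_subsets s k A" and ?W = "stable_subsets s k B"
  define M where "M = Max (c ` (?V \<union> ?W))"
  have "finite (?V \<union> ?W)"
    using assms(4,5) by (simp add: finite_stable_subsets finite_subset)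
  then have M: "M \<in> c ` (?V \<union> ?W)" unfolding M_def using False by (intro Max_in) auto
  have "c S \<noteq> c T" if "S \<in> ?V" "T \<in> ?W" for S T
    using kneser_coloring_disjoint[OF assms(3-6) that] .
  then have "c ` ?V \<inter> c ` ?W = {}" by blast
  then have "M \<in> c ` ?V \<longleftrightarrow> M \<notin> c ` ?W" using M by (metis IntI UnE empty_iff image_Un)
  moreover have "kneser_label c s k A B = (if M \<in> c ` ?V then int (s * (k - 1) + M) else - int (s * (k - 1) + M))"
    using False by (simp only: kneser_label_def Let_def if_False M_def)
  moreover have "kneser_label c s k B A = (if M \<in> c ` ?W then int (s * (k - 1) + M) else - int (s * (k - 1) + M))"
    using False by (simp only: kneser_label_def Let_def if_False M_def Un_commute[of ?W ?V])
  ultimately show ?thesis by (simp only: if_not_P if_P split: if_split) simp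
qed

text \<open>Two colour labels cancel only if a vertex on one side of the smaller pair and a vertex
  on the opposite side of the larger pair share a colour; these are disjoint, against properness. A
  level label and a colour label differ in absolute value.\<close>

lemma kneser_label_mono:
  assumes "s \<ge> 2" "k \<ge> 2" "kneser_coloring n k s c" "A' \<subseteq> {1..n}" "B' \<subseteq> {1..n}"
    and "A' \<inter> B' = {}" "A \<union> B \<noteq> {}" "A \<subseteq> A'" "B \<subseteq> B'"
  shows "kneser_label c s k A B + kneser_label c s k A' B' \<noteq> 0"
proof -
  let ?U = "stable_subsets s k A \<union> stable_subsets s k B"
  let ?U' = "stable_subsets s k A' \<union> stable_subsets s k B'"
  have sub: "A \<subseteq> {1..n}" "B \<subseteq> {1..n}" using assms(4,5,8,9) by auto
  then have fin: "finite A'" "finite B'" "finite A" "finite B" using assms(4,5) by (simp_all add: finite_subset)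
  have UU: "?U \<subseteq> ?U'"
    using stable_subsets_mono[OF assms(8)] stable_subsets_mono[OF assms(9)] by blast
  consider "?U' = {}" | "?U = {}" "?U' \<noteq> {}" | "?U \<noteq> {}" by blast
  then show ?thesis
  proof cases
    case 1
    moreover have "?U = {}" using 1 UU by blast
    moreover have "k - 2 + 2 = k" using assms by simp
    ultimately show ?thesis
      using level_label_mono[of s A' B' A B "k - 2"] assms fin by (simp add: kneser_label_def)
  next
    case 2
    have "\<bar>kneser_label c s k A B\<bar> \<le> int (s * (k - 1))"
      using kneser_label_small[OF 2(1) assms(1,2) fin(3,4) assms(7)] by blast
    moreover obtain S where "\<bar>kneser_label c s k A' B'\<bar> = int (s * (k - 1) + c S)" "c S > 0"
      using kneser_label_large[OF 2(2) assms(3-5)] by blast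
    ultimately show ?thesis by linarith
  next
    case 3
    have ne': "?U' \<noteq> {}" using 3 UU by blast
    let ?l = "kneser_label c s k A B" and ?l' = "kneser_label c s k A' B'"
    obtain S where S: "S \<in> stable_subsets s k (if ?l > 0 then A else B)"
      "\<bar>?l\<bar> = int (s * (k - 1) + c S)" "c S > 0"
      using kneser_label_large[OF 3 assms(3) sub] by blast
    obtain T where T: "T \<in> stable_subsets s k (if ?l' > 0 then A' else B')"
      "\<bar>?l'\<bar> = int (s * (k - 1) + c T)" "c T > 0"
      using kneser_label_large[OF ne' assms(3-5)] by blast
    show ?thesis
    proof
      assume z: "?l + ?l' = 0"
      then have eq: "c S = c T" and sgn: "?l > 0 \<longleftrightarrow> \<not> ?l' > 0"
        using S(2,3) T(2,3) by linarith+
      show False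
      proof (cases "?l > 0")
        case True
        have "A \<inter> B' = {}" using assms(6,8) by blast
        have "c S \<noteq> c T"
          using S(1) T(1) True sgn \<open>A \<inter> B' = {}\<close> kneser_coloring_disjoint[OF assms(3) sub(1) assms(5)]
          by simp
        then show False using eq by simp
      next
        case False
        have "A' \<inter> B = {}" using assms(6,9) by blast
        then have "c T \<noteq> c S"
          using S(1) T(1) False sgn kneser_coloring_disjoint[OF assms(3,4) sub(2)]
          by simp
        then show False using eq by simp
      qed
    qed
  qed
qed

definition pos_part :: "int set \<Rightarrow> nat set" where
  "pos_part X = {i. int i \<in> X}"

definition neg_part :: "int set \<Rightarrow> nat set" where
  "neg_part X = {i. - int i \<in> X}"

lemma pos_part_uminus [simp]: "pos_part (uminus ` X) = neg_part X"
  and neg_part_uminus [simp]: "neg_part (uminus ` X) = pos_part X"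
  by (force simp: pos_part_def neg_part_def)+

lemma signed_set_parts:
  assumes "X \<in> signed_sets n"
  shows "pos_part X \<subseteq> {1..n}" "neg_part X \<subseteq> {1..n}" "pos_part X \<inter> neg_part X = {}"
    "pos_part X \<union> neg_part X \<noteq> {}"
proof -
  have sub: "\<bar>x\<bar> \<in> {1..int n}" if "x \<in> X" for x
    using assms that by (auto simp: signed_sets_def)
  show p: "pos_part X \<subseteq> {1..n}" and "neg_part X \<subseteq> {1..n}"
    using sub by (fastforce simp: pos_part_def neg_part_def)+
  show "pos_part X \<inter> neg_part X = {}"
  proof (rule ccontr)
    assume "pos_part X \<inter> neg_part X \<noteq> {}"
    then obtain i where i: "int i \<in> X" "- int i \<in> X" by (auto simp: pos_part_def neg_part_def)
    moreover have "inj_on abs X" using assms by (simp add: signed_sets_def)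
    ultimately have "int i = - int i" by (metis abs_minus_cancel inj_onD)
    then show False using sub[OF i(1)] by simp
  qed
  obtain x where x: "x \<in> X" using assms by (auto simp: signed_sets_def)
  obtain i where "x = int i \<or> x = - int i" by (metis int_cases2)
  then show "pos_part X \<union> neg_part X \<noteq> {}" using x by (auto simp: pos_part_def neg_part_def)
qed

lemma fan_labelling_kneser_label:
  assumes "s \<ge> 2" "k \<ge> 2" "kneser_coloring n k s c"
  shows "fan_labelling n (\<lambda>X. kneser_label c s k (pos_part X) (neg_part X))"
  unfolding fan_labelling_def
proof (intro conjI ballI impI)
  fix X assume X: "X \<in> signed_sets n"
  show "kneser_label c s k (pos_part (uminus ` X)) (neg_part (uminus ` X)) =
        - kneser_label c s k (pos_part X) (neg_part X)"
    using kneser_label_swap[OF assms] signed_set_parts[OF X] by simp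
  fix Y assume Y: "Y \<in> signed_sets n" "X \<subseteq> Y"
  then have "pos_part X \<subseteq> pos_part Y" "neg_part X \<subseteq> neg_part Y"
    by (auto simp: pos_part_def neg_part_def)
  then show "kneser_label c s k (pos_part X) (neg_part X) +
        kneser_label c s k (pos_part Y) (neg_part Y) \<noteq> 0"
    using kneser_label_mono[OF assms signed_set_parts(1-3)[OF Y(1)] signed_set_parts(4)[OF X]] by simp
qed

section \<open>The zig-zag subgraph\<close>

text \<open>Indices start at 0 and absolute values at 1, so the entries from index \<open>q\<close>
  on exceed \<open>q\<close> in absolute value. This is how colour labels are recognised.\<close>

lemma strictly_sorted_abs_ge:
  assumes "sorted_wrt (<) (map abs ys)" "0 \<notin> set ys" "i < length ys"
  shows "int i < \<bar>ys ! i :: int\<bar>"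
  using assms(3)
proof (induction i)
  case 0
  then have "ys ! 0 \<noteq> 0" using assms(2) by (metis nth_mem)
  then show ?case by simp
next
  case (Suc i)
  have "map abs ys ! i < map abs ys ! Suc i"
    using assms(1) Suc.prems by (intro sorted_wrt_nth_less) auto
  then show ?case using Suc by simp
qed

lemma card_even_less: "card {i. i < t \<and> even i} = Suc t div 2"
  and card_odd_less: "card {i. i < t \<and> odd i} = t div 2"
proof (induction t)
  case (Suc t)
  have "{i. i < Suc t \<and> P i} = (if P t then insert t {i. i < t \<and> P i} else {i. i < t \<and> P i})"
    for P :: "nat \<Rightarrow> bool"
    by (auto simp: less_Suc_eq)
  then show "card {i. i < Suc t \<and> even i} = Suc (Suc t) div 2"
    and "card {i. i < Suc t \<and> odd i} = Suc t div 2"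
    using Suc by auto
qed simp_all

lemma zigzag_sequence:
  assumes "s \<ge> 2" "k \<ge> 2" "kneser_coloring n k s c" "t = n - s * (k - 1)"
  obtains P N f where "P \<subseteq> {1..n}" "N \<subseteq> {1..n}" "P \<inter> N = {}"
    "\<forall>i<t. f i \<in> stable_subsets s k (if even i then P else N)"
    "strict_mono_on {..<t} (c \<circ> f)"
proof -
  define q where "q = s * (k - 1)"
  define l where "l X = kneser_label c s k (pos_part X) (neg_part X)" for X
  have fan: "fan_labelling n l"
    using fan_labelling_kneser_label[OF assms(1-3)] by (simp add: l_def[abs_def])
  obtain xs ys where xs: "xs \<in> facets n" and ms: "mset ys = mset (chain_labels l xs)"
    and srt: "sorted_wrt (<) (map abs ys)" and alt: "alternating True ys"
    using fan_lemma[OF fan] .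
  have len: "length ys = n" "length xs = n"
    using length_facets[OF xs] mset_eq_length[OF ms] by auto
  have set: "set ys = set (chain_labels l xs)" using ms by (rule mset_eq_setD)
  have nz: "0 \<notin> set ys"
    using noncomplementary_chain_labels[OF fan xs] set by (force simp: noncomplementary_def)
  let ?P = "pos_part (set xs)" and ?N = "neg_part (set xs)"
  have PN: "?P \<subseteq> {1..n} \<and> ?N \<subseteq> {1..n} \<and> ?P \<inter> ?N = {}"
  proof (cases n)
    case 0
    then show ?thesis using len by (simp add: pos_part_def neg_part_def)
  next
    case (Suc m)
    then have "set xs \<in> signed_sets n"
      using signed_sets_take_facet[OF xs, of m] len by simp
    then show ?thesis using signed_set_parts by blast
  qed
  have "\<exists>S. S \<in> stable_subsets s k (if even (q + i) then ?P else ?N) \<and> \<bar>ys ! (q + i)\<bar> = int (q + c S)"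
    if i: "i < t" for i
  proof -
    let ?y = "ys ! (q + i)"
    have lt: "q + i < n" using i assms(4) by (simp add: q_def)
    have "?y \<in> set (chain_labels l xs)" using set len lt by (metis nth_mem)
    then obtain j where j: "j < n" "?y = l (set (take (Suc j) xs))"
      using len by (auto simp: chain_labels_def)
    define X where "X = set (take (Suc j) xs)"
    have X: "X \<in> signed_sets n" "X \<subseteq> set xs"
      using signed_sets_take_facet[OF xs j(1)] set_take_subset[of "Suc j" xs] by (simp_all add: X_def)
    note parts = signed_set_parts[OF X(1)]
    have yl: "?y = kneser_label c s k (pos_part X) (neg_part X)" using j by (simp add: l_def X_def)
    \<comment> \<open>Too large for a level label, so \<open>X\<close> contains a vertex.\<close>
    have large: "int q < \<bar>?y\<bar>" using strictly_sorted_abs_ge[OF srt nz, of "q + i"] lt len by simp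
    have "finite (pos_part X)" "finite (neg_part X)" using parts finite_subset by blast+
    then have "stable_subsets s k (pos_part X) \<union> stable_subsets s k (neg_part X) \<noteq> {}"
      using kneser_label_small(2)[OF _ assms(1,2) _ _ parts(4), of c] large yl
      by (metis linorder_not_le q_def)
    then obtain S where S: "S \<in> stable_subsets s k (if ?y > 0 then pos_part X else neg_part X)"
      "\<bar>?y\<bar> = int (q + c S)"
      using kneser_label_large[OF _ assms(3) parts(1,2)] yl q_def by metis
    have "?y > 0 \<longleftrightarrow> even (q + i)" using alternating_nth[OF alt] lt len by simp
    moreover have "pos_part X \<subseteq> ?P" "neg_part X \<subseteq> ?N" using X(2) by (auto simp: pos_part_def neg_part_def)
    then have "stable_subsets s k (pos_part X) \<subseteq> stable_subsets s k ?P"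
      "stable_subsets s k (neg_part X) \<subseteq> stable_subsets s k ?N"
      by (simp_all add: stable_subsets_mono)
    ultimately have "S \<in> stable_subsets s k (if even (q + i) then ?P else ?N)"
      using S(1) by (cases "even (q + i)") (simp_all add: subset_iff)
    then show ?thesis using S(2) by blast
  qed
  then obtain f where f: "\<And>i. i < t \<Longrightarrow> f i \<in> stable_subsets s k (if even (q + i) then ?P else ?N)"
    "\<And>i. i < t \<Longrightarrow> \<bar>ys ! (q + i)\<bar> = int (q + c (f i))"
    by metis
  have mono: "strict_mono_on {..<t} (c \<circ> f)"
  proof (rule strict_mono_onI)
    fix i j assume ij: "i \<in> {..<t}" "j \<in> {..<t}" "i < j"
    then have "map abs ys ! (q + i) < map abs ys ! (q + j)"
      using len assms(4) by (intro sorted_wrt_nth_less[OF srt]) (auto simp: q_def)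
    then have "\<bar>ys ! (q + i)\<bar> < \<bar>ys ! (q + j)\<bar>" using ij len assms(4) by (simp add: q_def)
    then show "(c \<circ> f) i < (c \<circ> f) j" using f(2)[of i] f(2)[of j] ij by simp
  qed
  show thesis
  \<comment> \<open>The entry at index \<open>q\<close> is positive exactly for even
    \<open>q\<close>; for odd \<open>q\<close> the two parts swap roles, so that \<open>f 0\<close>
    always lies in the first.\<close>
  proof (cases "even q")
    case True
    then show thesis using that[of ?P ?N f] PN f(1) mono by simp
  next
    case False
    have "f i \<in> stable_subsets s k (if even i then ?N else ?P)" if "i < t" for i
      using f(1)[OF that] False by (cases "even i") simp_all
    moreover have "?N \<inter> ?P = {}" using PN by blast
    ultimately show thesis using that[of ?N ?P f] PN mono by blast
  qed
qed

theorem theorem2p6: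
  fixes n k s t m :: nat and c :: "nat set \<Rightarrow> nat"
  assumes "n > 0" and "t > 0"
    and "k \<ge> 2" and "s \<ge> 2" and "n \<ge> s * k" and "t = n - s * (k - 1)"
    and "proper_coloring (almost_stable_kneser n k s) m c"
  shows "\<exists>A B. \<exists>col :: nat \<Rightarrow> nat.
           complete_bipartite_subgraph (almost_stable_kneser n k s)
             (nat \<lceil>real t / 2\<rceil>) (nat \<lfloor>real t / 2\<rfloor>) A B \<and>
           inj_on c (A \<union> B) \<and>
           strict_mono_on {1..t} col \<and>
           c ` A = col ` {i \<in> {1..t}. odd i} \<and>
           c ` B = col ` {i \<in> {1..t}. even i}"
proof -
  let ?G = "almost_stable_kneser n k s"
  have V: "pverts ?G = stable_subsets s k {1..n}"
    by (auto simp: almost_stable_kneser_def Let_def stable_subsets_def nsets_def)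
  have E: "parcs ?G = {(S, T). S \<in> pverts ?G \<and> T \<in> pverts ?G \<and> S \<inter> T = {}}"
    by (auto simp: almost_stable_kneser_def Let_def)
  have col: "kneser_coloring n k s c"
    unfolding kneser_coloring_def
  proof (intro conjI ballI impI)
    fix S assume S: "S \<in> stable_subsets s k {1..n}"
    then have "c S \<in> {1..m}" using assms(7) by (simp add: proper_coloring_def V Pi_iff)
    then show "c S > 0" by simp
    fix T assume "T \<in> stable_subsets s k {1..n}" "S \<inter> T = {}"
    with S have "(S, T) \<in> parcs ?G" by (simp add: E V)
    then show "c S \<noteq> c T" using assms(7) unfolding proper_coloring_def by blast
  qed
  obtain P N f where PN: "P \<subseteq> {1..n}" "N \<subseteq> {1..n}" "P \<inter> N = {}"
    and f: "\<forall>i<t. f i \<in> stable_subsets s k (if even i then P else N)"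
    and mono: "strict_mono_on {..<t} (c \<circ> f)"
    using zigzag_sequence[OF assms(4,3) col assms(6)] .
  define A where "A = f ` {i. i < t \<and> even i}"
  define B where "B = f ` {i. i < t \<and> odd i}"
  have injcf: "inj_on (c \<circ> f) {..<t}" using mono by (rule strict_mono_on_imp_inj_on)
  have injf: "inj_on f {..<t}" using injcf by (rule inj_on_imageI2)
  have cards: "card A = Suc t div 2" "card B = t div 2"
    unfolding A_def B_def
    by (subst card_image, rule inj_on_subset[OF injf], auto simp: card_even_less card_odd_less)+
  have ceil: "nat \<lceil>real t / 2\<rceil> = Suc t div 2" and floor: "nat \<lfloor>real t / 2\<rfloor> = t div 2"
    by linarith+
  have A: "S \<in> stable_subsets s k P" if "S \<in> A" for S using that f by (fastforce simp: A_def)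
  have B: "S \<in> stable_subsets s k N" if "S \<in> B" for S using that f by (fastforce simp: B_def)
  have AB: "A \<subseteq> pverts ?G" "B \<subseteq> pverts ?G"
    unfolding V using A B stable_subsets_mono[OF PN(1)] stable_subsets_mono[OF PN(2)] by blast+
  have "S \<inter> T = {}" if "S \<in> A" "T \<in> B" for S T
    using A[OF that(1)] B[OF that(2)] PN(3) by (auto simp: stable_subsets_def)
  then have arcs: "\<forall>S\<in>A. \<forall>T\<in>B. (S, T) \<in> parcs ?G"
    using subsetD[OF AB(1)] subsetD[OF AB(2)] unfolding E by simp
  \<comment> \<open>The colours are numbered from 1 but \<open>f\<close> from 0, so odd positions
    correspond to even indices, which make up \<open>A\<close>.\<close>
  have shift: "(\<lambda>i. c (f (i - 1))) ` {i \<in> {1..t}. Q i} = c ` f ` {i. i < t \<and> Q (Suc i)}" for Q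
  proof -
    have "{i \<in> {1..t}. Q i} = Suc ` {i. i < t \<and> Q (Suc i)}"
      by (auto simp: image_iff) (metis Suc_le_eq Suc_pred)
    then show ?thesis by (simp add: image_image)
  qed
  have "A \<inter> B = {}" using injf by (auto simp: A_def B_def inj_on_def)
  then have "complete_bipartite_subgraph ?G (nat \<lceil>real t / 2\<rceil>) (nat \<lfloor>real t / 2\<rfloor>) A B"
    using AB arcs cards ceil floor by (simp add: complete_bipartite_subgraph_def A_def B_def)
  moreover have "inj_on c (A \<union> B)"
  proof -
    have "A \<union> B = f ` {..<t}" by (auto simp: A_def B_def)
    then show ?thesis using injcf by (metis inj_on_imageI)
  qed
  moreover have "strict_mono_on {1..t} (\<lambda>i. c (f (i - 1)))"
  proof (rule strict_mono_onI)
    fix i j assume "i \<in> {1..t}" "j \<in> {1..t}" "i < j"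
    then show "c (f (i - 1)) < c (f (j - 1))"
      using strict_mono_onD[OF mono, of "i - 1" "j - 1"] by auto
  qed
  moreover have "c ` A = (\<lambda>i. c (f (i - 1))) ` {i \<in> {1..t}. odd i}"
    and "c ` B = (\<lambda>i. c (f (i - 1))) ` {i \<in> {1..t}. even i}"
    unfolding shift A_def B_def by simp_all
  ultimately show ?thesis by (intro exI conjI)
qed

end
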